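(* Let $1 \ge a_1 \ge a_2 \ge 0$ with $a_1^2 + a_2^2 = 1$, let $a=(a_1,a_2)$ and $0 \le t \le \sqrt 2$. Then for $n=2$: $$A_{\infty,\mathbb{C}}(a,t) = \begin{cases} \dfrac{\pi}{a_1^2}, & 0 \le t \le a_1 - a_2,\\[2mm] \phi(a_1,a_2,t), & a_1 - a_2 \le t < a_1 + a_2,\end{cases}$$ where $$\phi(a_1,a_2,t) = \frac{\pi}{2a_1^2} + \frac{1}{2a_1^2a_2^2}\left[\arcsin\!\left(\frac{1-t^2}{2a_1a_2}\right) + (a_1^2-a_2^2)\arcsin\!\left(\frac{4a_1^2a_2^2-(1-t^2)}{2a_1a_2t^2}\right) - \sqrt{4a_1^2a_2^2-(1-t^2)^2}\,\right].$$
   Context: Let $\mathbb{D} := \{z \in \mathbb{C} : |z| \le 1\}$ and let $B_\infty^n := \mathbb{D}^n \subset \mathbb{C}^n$ be the polydisc. For $a \in \mathbb{C}^n$ with $\|a\|_2 = 1$ and $t \in \mathbb{C}$ define $$A_{\infty,\mathbb{C}}(a,t) := \mathrm{vol}_{2(n-1)}(\{z \in B_\infty^n : \langle a,z\rangle = t\}),$$ where $\langle\cdot,\cdot\rangle$ is the scalar product in $\mathbb{C}^n$ and $\mathrm{vol}_{2(n-1)}$ is the real $2(n-1)$-dimensional Lebesgue measure, identifying $\mathbb{C}^n$ with $\mathbb{R}^{2n}$. Convention: in the degenerate situation $t = 0 = a_1-a_2$, where the expression for $\phi$ is formally undefined, the first case applies. *)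

theory Defs
  imports "HOL-Analysis.Analysis"
begin

definition cscalar :: "complex ^ 'n \<Rightarrow> complex ^ 'n \<Rightarrow> complex"
  where "cscalar a z = (\<Sum>i\<in>UNIV. a $ i * cnj (z $ i))"

definition polydisc :: "(complex ^ 'n) set"
  where "polydisc = {z. \<forall>i. norm (z $ i) \<le> 1}"

text \<open>The pair \<open>(p, b)\<close> is a Cartesian coordinate system of the \<open>m\<close>-dimensional affine
  subspace \<open>H\<close>: origin \<open>p\<close> and orthonormal directions \<open>b 0, \<dots>, b (m - 1)\<close> with respect to the
  real inner product. On \<^typ>\<open>complex ^ 'n\<close> this inner product is the one obtained by identifying
  the space with the real Euclidean space of dimension \<open>2n\<close>.\<close>

definition flat_frame ::
    "nat \<Rightarrow> 'a::euclidean_space set \<Rightarrow> 'a \<Rightarrow> (nat \<Rightarrow> 'a) \<Rightarrow> bool"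
  where "flat_frame m H p b \<longleftrightarrow>
    (\<forall>i<m. \<forall>j<m. b i \<bullet> b j = (if i = j then 1 else 0)) \<and>
    H = range (\<lambda>x. p + (\<Sum>i<m. x i *\<^sub>R b i))"

text \<open>The \<open>m\<close>-dimensional Lebesgue measure on \<open>H\<close>, transported from the \<open>m\<close>-fold product of
  \<^const>\<open>lborel\<close> by Cartesian coordinates. It does not depend on the chosen frame, since
  two frames of \<open>H\<close> differ by a Euclidean motion of the coordinates. It is only meaningful
  if \<open>H\<close> is an \<open>m\<close>-dimensional affine subspace.\<close>

definition flat_lborel :: "nat \<Rightarrow> 'a::euclidean_space set \<Rightarrow> 'a measure"
  where "flat_lborel m H =
    (let (p, b) = (SOME (p, b). flat_frame m H p b) in
      distr (Pi\<^sub>M {..<m} (\<lambda>_. lborel)) borel (\<lambda>x. p + (\<Sum>i<m. x i *\<^sub>R b i)))"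

text \<open>Meaningful for \<open>norm a = 1\<close>; the norm of \<^typ>\<open>complex ^ 'n\<close> is the Euclidean one.\<close>

definition A_inf_C :: "complex ^ 'n \<Rightarrow> complex \<Rightarrow> real"
  where "A_inf_C a t =
    measure (flat_lborel (2 * (CARD('n) - 1)) {z. cscalar a z = t})
      {z \<in> polydisc. cscalar a z = t}"

definition phi :: "real \<Rightarrow> real \<Rightarrow> real \<Rightarrow> real"
  where "phi a1 a2 t =
    pi / (2 * a1\<^sup>2) + 1 / (2 * a1\<^sup>2 * a2\<^sup>2) *
      (arcsin ((1 - t\<^sup>2) / (2 * a1 * a2))
       + (a1\<^sup>2 - a2\<^sup>2) * arcsin ((4 * a1\<^sup>2 * a2\<^sup>2 - (1 - t\<^sup>2)) / (2 * a1 * a2 * t\<^sup>2))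
       - sqrt (4 * a1\<^sup>2 * a2\<^sup>2 - (1 - t\<^sup>2)\<^sup>2))"

end

theory Submission
  imports Defs
begin

text \<open>
  The section is a disc or a lens in a complex line. On it the first coordinate is determined by the
  second one, \<open>w = z$2\<close>, and projecting to \<open>w\<close> multiplies areas by \<open>a1\<^sup>2\<close>
  (\<open>A_inf_C_eq_measure_discs\<close>). The image consists of the \<open>w\<close> in the unit disc with
  \<open>\<bar>t - a2 * w\<bar> \<le> a1\<close>, that is, for \<open>a2 > 0\<close>, in the disc of radius \<open>a1 / a2\<close> around \<open>t / a2\<close>.

  For \<open>t \<le> a1 - a2\<close> this is the whole unit disc, of area \<open>pi\<close>. Otherwise it is a lens bounded by
  two circular arcs, whose area \<open>measure_lens\<close> is expressed by the angles of a triangle with sides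
  proportional to \<open>a1\<close>, \<open>a2\<close>, \<open>t\<close>: with \<open>\<alpha>\<close> and \<open>\<beta>\<close> opposite to \<open>a1\<close> and \<open>a2\<close>, and \<open>S\<close> four times
  the area of the triangle with sides \<open>a1\<close>, \<open>a2\<close>, \<open>t\<close>, the section has area
  \<open>(2 * a2\<^sup>2 * \<alpha> + 2 * a1\<^sup>2 * \<beta> - S) / (2 * a1\<^sup>2 * a2\<^sup>2)\<close>. Since \<open>a1\<^sup>2 + a2\<^sup>2 = 1\<close>,
  \<open>2 * a2\<^sup>2 * \<alpha> + 2 * a1\<^sup>2 * \<beta> = (\<alpha> + \<beta>) + (a1\<^sup>2 - a2\<^sup>2) * (\<beta> - \<alpha>)\<close>, and the sum and the
  difference of the two angles are the two arcsines of \<open>phi\<close> up to a right angle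
  (\<open>triangle_angles\<close>).
\<close>

section \<open>Vectors with two components\<close>

lemma vec2_eq_iff: "(v::'a^2) = w \<longleftrightarrow> v$1 = w$1 \<and> v$2 = w$2"
  by (simp add: vec_eq_iff forall_2)

lemma norm_vec2_le_iff: "norm (v::real^2) \<le> r \<longleftrightarrow> 0 \<le> r \<and> (v$1)\<^sup>2 + (v$2)\<^sup>2 \<le> r\<^sup>2"
proof -
  have eq: "(norm v)\<^sup>2 = (v$1)\<^sup>2 + (v$2)\<^sup>2"
    by (simp add: norm_vec_def L2_set_def sum_2)
  show ?thesis
    unfolding eq[symmetric] by (metis norm_ge_zero order_trans power2_le_imp_le power_mono)
qed

lemma prod_Basis_vec2: "prod f (Basis :: (real^2) set) = f (axis 1 1) * f (axis 2 1)"
proof -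
  have B: "(Basis :: (real^2) set) = {axis 1 1, axis 2 1}"
    by (auto simp: Basis_vec_def UNIV_2)
  have "axis 1 1 \<noteq> (axis 2 1 :: real^2)" by (simp add: axis_eq_axis)
  then show ?thesis unfolding B by simp
qed

section \<open>Lebesgue measure of the plane\<close>

text \<open>The plane occurs as \<open>real^2\<close>, on which orthogonal maps act, as
  \<open>real \<times> real\<close>, where areas are computed by slicing, and as a product over \<open>{..<2}\<close>, the coordinate
  space of frames. The following lemmas identify the three measures by their values on boxes.\<close>

lemma lborel_vec2_eqI:
  assumes "sets M = sets borel"
    and "\<And>a b c d. a \<le> b \<Longrightarrow> c \<le> d \<Longrightarrow>
      emeasure M {v::real^2. v$1 \<in> {a<..<b} \<and> v$2 \<in> {c<..<d}} = ennreal (b - a) * ennreal (d - c)"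
  shows "lborel = M"
proof (rule lborel_eqI)
  fix l u :: "real^2"
  assume "\<And>b. b \<in> Basis \<Longrightarrow> l \<bullet> b \<le> u \<bullet> b"
  then have le: "l$1 \<le> u$1" "l$2 \<le> u$2"
    by (simp_all add: cart_eq_inner_axis)
  have "box l u = {v. v$1 \<in> {l$1<..<u$1} \<and> v$2 \<in> {l$2<..<u$2}}"
    by (auto simp: mem_box_cart forall_2)
  then show "emeasure M (box l u) = ennreal (\<Prod>b\<in>Basis. (u - l) \<bullet> b)"
    using le assms(2)[OF le]
    by (simp add: prod_Basis_vec2 inner_diff_left ennreal_mult flip: cart_eq_inner_axis)
qed (fact assms(1))

lemma measurable_vector2 [measurable]:
  assumes "f \<in> borel_measurable M" "g \<in> borel_measurable M"
  shows "(\<lambda>x. vector [f x, g x] :: real^2) \<in> borel_measurable M"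
proof -
  have eq: "(vector [a, b] :: real^2) = a *\<^sub>R axis 1 1 + b *\<^sub>R axis 2 1" for a b
    by (simp add: vec2_eq_iff axis_def)
  show ?thesis unfolding eq using assms by measurable
qed

lemma lborel_vec2_pair:
  "(lborel :: (real^2) measure) = distr (lborel \<Otimes>\<^sub>M lborel) borel (\<lambda>(x, y). vector [x, y])"
proof (rule lborel_vec2_eqI)
  fix a b c d :: real assume le: "a \<le> b" "c \<le> d"
  have [measurable]: "{v::real^2. v$1 \<in> {a<..<b} \<and> v$2 \<in> {c<..<d}} \<in> sets borel" by measurable
  have eq: "(\<lambda>(x, y). vector [x, y] :: real^2) -` {v. v$1 \<in> {a<..<b} \<and> v$2 \<in> {c<..<d}}
    = {a<..<b} \<times> {c<..<d}" by auto
  show "emeasure (distr (lborel \<Otimes>\<^sub>M lborel) borel (\<lambda>(x, y). vector [x, y]))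
      {v::real^2. v$1 \<in> {a<..<b} \<and> v$2 \<in> {c<..<d}} = ennreal (b - a) * ennreal (d - c)"
    using le by (subst emeasure_distr)
      (simp_all only: eq space_pair_measure, simp_all add: lborel.emeasure_pair_measure_Times)
qed simp

lemma lborel_vec2_PiM:
  "(lborel :: (real^2) measure) = distr (Pi\<^sub>M {..<2::nat} (\<lambda>_. lborel)) borel (\<lambda>x. vector [x 0, x 1])"
proof (rule lborel_vec2_eqI)
  fix a b c d :: real assume le: "a \<le> b" "c \<le> d"
  interpret product_sigma_finite "\<lambda>_::nat. lborel :: real measure" by standard
  define I where "I i = (if i = 0 then {a<..<b} else {c<..<d})" for i :: nat
  have box: "{v::real^2. v$1 \<in> {a<..<b} \<and> v$2 \<in> {c<..<d}} \<in> sets borel" by measurable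
  have vec: "(\<lambda>x. vector [x 0, x 1] :: real^2) \<in> borel_measurable (Pi\<^sub>M {..<2::nat} (\<lambda>_. lborel))"
    by measurable
  have eq: "(\<lambda>x. vector [x 0, x 1] :: real^2) -` {v. v$1 \<in> {a<..<b} \<and> v$2 \<in> {c<..<d}}
    \<inter> space (Pi\<^sub>M {..<2::nat} (\<lambda>_. lborel)) = Pi\<^sub>E {..<2} I"
  proof -
    have "(\<forall>i\<in>{..<2}. x i \<in> I i) \<longleftrightarrow> x 0 \<in> {a<..<b} \<and> x 1 \<in> {c<..<d}" for x
      by (auto simp: I_def numeral_2_eq_2 less_Suc_eq)
    then show ?thesis by (simp add: space_PiM PiE_def set_eq_iff Pi_iff)
  qed
  have "emeasure (Pi\<^sub>M {..<2::nat} (\<lambda>_. lborel)) (Pi\<^sub>E {..<2} I) = (\<Prod>i<2. emeasure lborel (I i))"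
    by (rule emeasure_PiM) (auto simp: I_def)
  also have "\<dots> = ennreal (b - a) * ennreal (d - c)"
    using le by (simp add: numeral_2_eq_2 I_def lessThan_Suc mult.commute)
  finally show "emeasure (distr (Pi\<^sub>M {..<2::nat} (\<lambda>_. lborel)) borel (\<lambda>x. vector [x 0, x 1]))
      {v::real^2. v$1 \<in> {a<..<b} \<and> v$2 \<in> {c<..<d}} = ennreal (b - a) * ennreal (d - c)"
    by (simp only: emeasure_distr[OF vec box] eq)
qed simp

section \<open>Circular segments and lenses\<close>

lemma has_integral_chord_length:
  fixes c r :: real
  assumes "0 < r" "-r \<le> c" "c \<le> r"
  shows "((\<lambda>x. 2 * sqrt (r\<^sup>2 - x\<^sup>2)) has_integral (r\<^sup>2 * arccos (c / r) - c * sqrt (r\<^sup>2 - c\<^sup>2))) {c..r}"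
proof -
  define F where "F x = x * sqrt (r\<^sup>2 - x\<^sup>2) - r\<^sup>2 * arccos (x / r)" for x
  have "((\<lambda>x. 2 * sqrt (r\<^sup>2 - x\<^sup>2)) has_integral (F r - F c)) {c..r}"
    \<comment> \<open>At \<open>x = \<plusminus> r\<close> the antiderivative is continuous, although its two summands are not differentiable.\<close>
  proof (rule fundamental_theorem_of_calculus_interior)
    show "continuous_on {c..r} F"
      unfolding F_def using assms by (auto intro!: continuous_intros simp: field_simps)
    fix x assume x: "x \<in> {c<..<r}"
    then have "\<bar>x\<bar> < r" using assms by auto
    then have pos: "r\<^sup>2 - x\<^sup>2 > 0"
      using power_strict_mono[of "\<bar>x\<bar>" r 2] by simp
    have "1 - (x/r)\<^sup>2 = (r\<^sup>2 - x\<^sup>2) / r\<^sup>2" using assms by (simp add: field_simps)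
    then have s: "sqrt (1 - (x/r)\<^sup>2) = sqrt (r\<^sup>2 - x\<^sup>2) / r"
      using assms by (simp add: real_sqrt_divide)
    define q where "q = sqrt (r\<^sup>2 - x\<^sup>2)"
    have q: "q > 0" "q\<^sup>2 = r\<^sup>2 - x\<^sup>2" using pos by (auto simp: q_def)
    have "(F has_real_derivative
        (q - x\<^sup>2 / q) + r / (q / r)) (at x)"
      unfolding F_def using assms x pos
      apply (auto intro!: derivative_eq_intros simp: s simp flip: q_def)
      using q(1) assms(1) by (simp_all add: field_simps power2_eq_square)
    moreover have "(q - x\<^sup>2 / q) + r / (q / r) = 2 * q"
      using q assms by (simp add: field_simps power2_eq_square)
    ultimately have "(F has_real_derivative 2 * q) (at x)" by (simp only:)
    then show "(F has_vector_derivative 2 * sqrt (r\<^sup>2 - x\<^sup>2)) (at x)"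
      by (simp add: q_def has_real_derivative_iff_has_vector_derivative)
  qed (use assms in auto)
  moreover have "F r - F c = r\<^sup>2 * arccos (c / r) - c * sqrt (r\<^sup>2 - c\<^sup>2)"
    using assms by (simp add: F_def)
  ultimately show ?thesis by simp
qed

text \<open>By Fubini the area of the segment cut off a disc is the integral of the lengths
  \<open>2 * sqrt (r\<^sup>2 - x\<^sup>2)\<close> of its vertical chords.\<close>

lemma measure_disc_segment:
  assumes "0 < r" "-r \<le> c" "c \<le> r"
  shows "measure lebesgue {v::real^2. norm v \<le> r \<and> c \<le> v$1}
    = r\<^sup>2 * arccos (c / r) - c * sqrt (r\<^sup>2 - c\<^sup>2)" (is "measure lebesgue ?S = ?A")
proof -
  have [measurable]: "?S \<in> sets borel" by measurable
  let ?P = "{p::real \<times> real. norm (vector [fst p, snd p] :: real^2) \<le> r \<and> c \<le> fst p}"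
  have slice: "emeasure lborel (Pair x -` ?P)
      = ennreal (2 * sqrt (r\<^sup>2 - x\<^sup>2)) * indicator {c..r} x" for x
  proof (cases "x \<in> {c..r}")
    case True
    then have "x\<^sup>2 \<le> r\<^sup>2" using assms abs_le_square_iff[of x r] by auto
    moreover from this have "Pair x -` ?P = {- sqrt (r\<^sup>2 - x\<^sup>2)..sqrt (r\<^sup>2 - x\<^sup>2)}"
      using True assms
      by (auto simp: norm_vec2_le_iff abs_le_iff[symmetric] minus_le_iff intro!: real_le_rsqrt)
         (smt (verit) real_sqrt_le_iff real_sqrt_abs)+
    ultimately show ?thesis using True by simp
  next
    case False
    have "x \<le> r" if "x\<^sup>2 + y\<^sup>2 \<le> r\<^sup>2" for y
      using that assms by (intro power2_le_imp_le[of x r]) (auto intro: order_trans[OF _ that])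
    then have "Pair x -` ?P = {}" using False by (auto simp: norm_vec2_le_iff)
    then show ?thesis using False by (simp del: vimage_Collect_eq)
  qed
  have P: "?P \<in> sets (lborel \<Otimes>\<^sub>M lborel)"
  proof -
    have "?P = {p \<in> space (lborel \<Otimes>\<^sub>M lborel). norm (vector [fst p, snd p] :: real^2) \<le> r \<and> c \<le> fst p}"
      by (simp add: space_pair_measure)
    also have "\<dots> \<in> sets (lborel \<Otimes>\<^sub>M lborel)" by measurable
    finally show ?thesis .
  qed
  have "emeasure lborel ?S = emeasure (lborel \<Otimes>\<^sub>M lborel) ?P"
    by (subst lborel_vec2_pair, subst emeasure_distr)
       (auto simp: space_pair_measure intro!: arg_cong[where f="emeasure _"])
  also have "\<dots> = (\<integral>\<^sup>+x. emeasure lborel (Pair x -` ?P) \<partial>lborel)"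
    by (rule lborel.emeasure_pair_measure_alt[OF P])
  also have "\<dots> = (\<integral>\<^sup>+x. ennreal (2 * sqrt (r\<^sup>2 - x\<^sup>2)) * indicator {c..r} x \<partial>lborel)"
    by (simp only: slice)
  also have "\<dots> = ennreal ?A"
  proof (rule nn_integral_has_integral_lebesgue'[OF _ has_integral_chord_length[OF assms]])
    fix x assume "x \<in> {c..r}"
    then show "0 \<le> 2 * sqrt (r\<^sup>2 - x\<^sup>2)" using assms abs_le_square_iff[of x r] by auto
  qed
  finally have "emeasure lborel ?S = ennreal ?A" .
  moreover have "0 \<le> ?A"
  proof (rule has_integral_nonneg[OF has_integral_chord_length[OF assms]])
    fix x assume "x \<in> {c..r}"
    then show "0 \<le> 2 * sqrt (r\<^sup>2 - x\<^sup>2)" using assms abs_le_square_iff[of x r] by auto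
  qed
  moreover have "measure lebesgue ?S = measure lborel ?S" by simp
  ultimately show ?thesis by (simp only: measure_eq_emeasure_eq_ennreal)
qed

text \<open>The two circles meet on the vertical line \<open>x = c\<close>, where the powers of a point with respect to
  both circles agree. Right of it the first disc lies in the second, left of it the second in the
  first, so the line cuts the lens into a segment of each disc. The segments have the common chord of
  half-length \<open>sqrt (r\<^sup>2 - c\<^sup>2)\<close> and the
  signed distances \<open>c\<close> and \<open>d - c\<close> from the centres. The hypotheses on
  \<open>d\<close> say that \<open>d\<close>, \<open>r\<close>, \<open>R\<close> are the sides of a possibly degenerate triangle; equivalently, the
  chord exists.\<close>

lemma measure_lens:
  fixes d r R :: real
  assumes "0 < r" "0 < R" "0 < d" "d \<le> r + R" "\<bar>r - R\<bar> \<le> d"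
  shows "measure lebesgue {v::real^2. norm v \<le> r \<and> norm (v - vector [d, 0]) \<le> R}
    = r\<^sup>2 * arccos ((d\<^sup>2 + r\<^sup>2 - R\<^sup>2) / (2 * d * r)) + R\<^sup>2 * arccos ((d\<^sup>2 + R\<^sup>2 - r\<^sup>2) / (2 * d * R))
      - sqrt (4 * d\<^sup>2 * r\<^sup>2 - (d\<^sup>2 + r\<^sup>2 - R\<^sup>2)\<^sup>2) / 2"
    (is "measure lebesgue ?L = _")
proof -
  define c where "c = (d\<^sup>2 + r\<^sup>2 - R\<^sup>2) / (2 * d)"
  define e where "e = (d\<^sup>2 + R\<^sup>2 - r\<^sup>2) / (2 * d)"
  have ce: "e = d - c" using assms by (simp add: c_def e_def field_simps power2_eq_square)
  have two: "2 * d * c = d\<^sup>2 + r\<^sup>2 - R\<^sup>2" using assms by (simp add: c_def)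
  define S where "S = {v::real^2. norm v \<le> r \<and> c \<le> v$1}"
  define T where "T = {v::real^2. norm v \<le> R \<and> e \<le> v$1}"
  \<comment> \<open>The point reflection exchanging the two centres moves \<open>T\<close> into its position in the lens.\<close>
  define T' where "T' = (\<lambda>v. vector [d, 0] - v) ` T"
  have range_c: "-r \<le> c" "c \<le> r"
  proof -
    have "R\<^sup>2 \<le> (d + r)\<^sup>2" using assms by (intro power_mono) auto
    then have "0 \<le> 2 * d * (c + r)" using two by (simp add: power2_eq_square algebra_simps)
    then show "-r \<le> c" using assms by (simp add: zero_le_mult_iff mult_le_0_iff)
    have "(d - r)\<^sup>2 \<le> R\<^sup>2" using assms by (intro abs_le_square_iff[THEN iffD1]) auto
    then have "0 \<le> 2 * d * (r - c)" using two by (simp add: power2_eq_square algebra_simps)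
    then show "c \<le> r" using assms by (simp add: zero_le_mult_iff)
  qed
  have two_e: "2 * d * e = d\<^sup>2 + R\<^sup>2 - r\<^sup>2" using assms by (simp add: e_def)
  have range_e: "-R \<le> e" "e \<le> R"
  proof -
    have "r\<^sup>2 \<le> (d + R)\<^sup>2" using assms by (intro power_mono) auto
    then have "0 \<le> 2 * d * (e + R)" using two_e by (simp add: power2_eq_square algebra_simps)
    then show "-R \<le> e" using assms by (simp add: zero_le_mult_iff)
    have "(d - R)\<^sup>2 \<le> r\<^sup>2" using assms by (intro abs_le_square_iff[THEN iffD1]) auto
    then have "0 \<le> 2 * d * (R - e)" using two_e by (simp add: power2_eq_square algebra_simps)
    then show "e \<le> R" using assms by (simp add: zero_le_mult_iff)
  qed
  have T': "T' = {v::real^2. norm (v - vector [d, 0]) \<le> R \<and> v$1 \<le> c}"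
  proof -
    have "v \<in> T'" if "norm (v - vector [d, 0]) \<le> R" "v$1 \<le> c" for v :: "real^2"
      unfolding T'_def using that
      by (intro image_eqI[of _ _ "vector [d, 0] - v"]) (auto simp: T_def ce norm_minus_commute)
    then show ?thesis by (auto simp: T'_def T_def ce)
  qed
  have dist_diff: "(v$1 - d)\<^sup>2 + (v$2)\<^sup>2 - R\<^sup>2 = (v$1)\<^sup>2 + (v$2)\<^sup>2 - r\<^sup>2 + 2 * d * (c - v$1)" for v :: "real^2"
    using two by (simp add: power2_eq_square algebra_simps)
  have "?L = S \<union> T'"
  proof -
    have "norm (v - vector [d, 0]) \<le> R" if "norm v \<le> r" "c \<le> v$1" for v :: "real^2"
      using that dist_diff[of v] assms mult_nonneg_nonpos[of "2 * d" "c - v$1"]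
      by (simp add: norm_vec2_le_iff)
    moreover have "norm v \<le> r" if "norm (v - vector [d, 0]) \<le> R" "v$1 \<le> c" for v :: "real^2"
    proof -
      have "0 \<le> 2 * d * (c - v$1)" using that assms by simp
      moreover have "(v$1 - d)\<^sup>2 + (v$2)\<^sup>2 \<le> R\<^sup>2" using that by (simp add: norm_vec2_le_iff)
      ultimately show ?thesis using dist_diff[of v] assms unfolding norm_vec2_le_iff by linarith
    qed
    ultimately show ?thesis unfolding S_def T' by (auto simp: not_le)
  qed
  moreover have meas: "S \<in> lmeasurable" "T \<in> lmeasurable" "T' \<in> lmeasurable"
  proof -
    have "compact (cball 0 \<rho> \<inter> {v::real^2. x \<le> v$1})" for \<rho> x
      by (intro compact_Int_closed closed_Collect_le continuous_intros) auto
    moreover have "{v::real^2. norm v \<le> \<rho> \<and> x \<le> v$1} = cball 0 \<rho> \<inter> {v. x \<le> v$1}" for \<rho> x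
      by auto
    ultimately have C: "compact S" "compact T" by (simp_all add: S_def T_def)
    moreover have "compact T'"
      unfolding T'_def by (intro compact_continuous_image C continuous_intros)
    ultimately show "S \<in> lmeasurable" "T \<in> lmeasurable" "T' \<in> lmeasurable"
      by (simp_all add: lmeasurable_compact)
  qed
  have "negligible (S \<inter> T')"
    by (rule negligible_subset[OF negligible_standard_hyperplane[of "axis 1 1" c]])
       (auto simp: S_def T' simp flip: cart_eq_inner_axis)
  then have "measure lebesgue (S \<inter> T') = 0" by (rule negligible_imp_measure0)
  then have "measure lebesgue (S \<union> T') = measure lebesgue S + measure lebesgue T'"
    using meas by (simp add: measure_Un3)
  moreover have "measure lebesgue T' = measure lebesgue T"
  proof -
    have "T' = (+) (vector [d, 0]) ` ((\<lambda>v. - v) ` T)" by (auto simp: T'_def image_image)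
    then have "measure lebesgue T' = measure lebesgue ((\<lambda>v. - v) ` T)"
      by (simp add: measure_translation)
    also have "\<dots> = measure lebesgue T"
      by (intro measure_orthogonal_image meas) (simp add: orthogonal_transformation_def linear_iff)
    finally show ?thesis .
  qed
  moreover have "measure lebesgue S = r\<^sup>2 * arccos (c / r) - c * sqrt (r\<^sup>2 - c\<^sup>2)"
    unfolding S_def by (rule measure_disc_segment) (use assms range_c in auto)
  moreover have "measure lebesgue T = R\<^sup>2 * arccos (e / R) - e * sqrt (R\<^sup>2 - e\<^sup>2)"
    unfolding T_def by (rule measure_disc_segment) (use assms range_e in auto)
  moreover have "R\<^sup>2 - e\<^sup>2 = r\<^sup>2 - c\<^sup>2"
    using two by (simp add: ce power2_eq_square algebra_simps)
  moreover have "d * sqrt (r\<^sup>2 - c\<^sup>2) = sqrt (4 * d\<^sup>2 * r\<^sup>2 - (d\<^sup>2 + r\<^sup>2 - R\<^sup>2)\<^sup>2) / 2"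
  proof -
    have "4 * d\<^sup>2 * r\<^sup>2 - (d\<^sup>2 + r\<^sup>2 - R\<^sup>2)\<^sup>2 = (2 * d)\<^sup>2 * (r\<^sup>2 - c\<^sup>2)"
      unfolding two[symmetric] by (simp add: power2_eq_square algebra_simps)
    then show ?thesis using assms by (simp add: real_sqrt_mult)
  qed
  moreover have "c / r = (d\<^sup>2 + r\<^sup>2 - R\<^sup>2) / (2 * d * r)" "e / R = (d\<^sup>2 + R\<^sup>2 - r\<^sup>2) / (2 * d * R)"
    by (simp_all add: c_def e_def)
  moreover have "c * sqrt (r\<^sup>2 - c\<^sup>2) + e * sqrt (r\<^sup>2 - c\<^sup>2) = d * sqrt (r\<^sup>2 - c\<^sup>2)"
    by (simp add: ce algebra_simps)
  ultimately show ?thesis by simp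
qed

section \<open>The angles of the triangle with sides \<open>a1\<close>, \<open>a2\<close>, \<open>t\<close>\<close>

text \<open>By the law of cosines, \<open>arccos x\<close> and \<open>arccos y\<close> are the angles opposite to \<open>a1\<close> and \<open>a2\<close>,
  and \<open>(1 - t\<^sup>2) / (2 * a1 * a2)\<close> is the cosine of the third angle since \<open>a1\<^sup>2 + a2\<^sup>2 = 1\<close>. The first
  identity is thus the angle sum of a triangle. For the second one, the argument of the arcsine is the
  cosine of the difference of the first two angles. Identifying arguments of arcsine with sines does
  not suffice: the right-hand sides have to lie between \<open>- pi / 2\<close> and \<open>pi / 2\<close>. This amounts to
  \<open>- y \<le> x\<close> and \<open>x \<le> y\<close>, which follow from the triangle inequalities and \<open>a2 \<le> a1\<close>.\<close>

lemma triangle_angles: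
  fixes a1 a2 t :: real
  assumes pos: "0 < a1" "0 < a2" "0 < t" and le: "a2 \<le> a1" and unit: "a1\<^sup>2 + a2\<^sup>2 = 1"
    and t: "a1 - a2 \<le> t" "t \<le> a1 + a2"
  defines "x \<equiv> (t\<^sup>2 + a2\<^sup>2 - a1\<^sup>2) / (2 * t * a2)" and "y \<equiv> (t\<^sup>2 + a1\<^sup>2 - a2\<^sup>2) / (2 * t * a1)"
  shows "arcsin ((1 - t\<^sup>2) / (2 * a1 * a2)) = arccos x + arccos y - pi / 2" (is ?thesis1)
    and "arcsin ((4 * a1\<^sup>2 * a2\<^sup>2 - (1 - t\<^sup>2)) / (2 * a1 * a2 * t\<^sup>2)) = arccos y - arccos x + pi / 2" (is ?thesis2)
proof -
  have x: "2 * t * a2 * x = t\<^sup>2 + a2\<^sup>2 - a1\<^sup>2" and y: "2 * t * a1 * y = t\<^sup>2 + a1\<^sup>2 - a2\<^sup>2"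
    using pos by (simp_all add: x_def y_def)
  have sq: "(a1 - a2)\<^sup>2 \<le> t\<^sup>2" "t\<^sup>2 \<le> (a1 + a2)\<^sup>2"
    using assms by (intro power_mono; simp)+
  have sq': "(t - a2)\<^sup>2 \<le> a1\<^sup>2" "(t - a1)\<^sup>2 \<le> a2\<^sup>2" "a1\<^sup>2 \<le> (t + a2)\<^sup>2" "a2\<^sup>2 \<le> (t + a1)\<^sup>2"
    using pos le t by (auto simp flip: abs_le_square_iff)
  have "0 \<le> 2 * t * a2 * (1 - x)" "0 \<le> 2 * t * a2 * (1 + x)"
       "0 \<le> 2 * t * a1 * (1 - y)" "0 \<le> 2 * t * a1 * (1 + y)"
    using sq' x y by (simp_all add: power2_eq_square algebra_simps)
  then have bd: "x \<le> 1" "-1 \<le> x" "y \<le> 1" "-1 \<le> y"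
    using pos by (simp_all add: zero_le_mult_iff mult_le_0_iff)
  have "2 * t * a1 * a2 * (x + y) = (a1 + a2) * (t\<^sup>2 - (a1 - a2)\<^sup>2)"
  proof -
    have "2 * t * a1 * a2 * (x + y) = a1 * (2 * t * a2 * x) + a2 * (2 * t * a1 * y)"
      by (simp add: algebra_simps)
    then show ?thesis unfolding x y by (simp add: power2_eq_square algebra_simps)
  qed
  moreover have "0 \<le> (a1 + a2) * (t\<^sup>2 - (a1 - a2)\<^sup>2)" using pos sq by simp
  ultimately have "0 \<le> 2 * t * a1 * a2 * (x + y)" by simp
  then have sum: "- y \<le> x" using pos by (simp add: zero_le_mult_iff mult_le_0_iff)
  have "2 * t * a1 * a2 * (y - x) = (a1 - a2) * ((a1 + a2)\<^sup>2 - t\<^sup>2)"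
  proof -
    have "2 * t * a1 * a2 * (y - x) = a2 * (2 * t * a1 * y) - a1 * (2 * t * a2 * x)"
      by (simp add: algebra_simps)
    then show ?thesis unfolding x y by (simp add: power2_eq_square algebra_simps)
  qed
  moreover have "0 \<le> (a1 - a2) * ((a1 + a2)\<^sup>2 - t\<^sup>2)" using le sq by simp
  ultimately have "0 \<le> 2 * t * a1 * a2 * (y - x)" by simp
  then have diff: "x \<le> y" using pos by (simp add: zero_le_mult_iff mult_le_0_iff)
  have ang: "arccos x + arccos y \<le> pi" "arccos y \<le> arccos x" "0 \<le> arccos x" "0 \<le> arccos y" "arccos x \<le> pi"
    using arccos_le_arccos[of "-y" x] arccos_minus[of y] arccos_le_arccos[of x y] sum diff bd
    by (auto simp: arccos_lbound arccos_ubound)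

  define s where "s = sqrt (1 - x\<^sup>2)"
  define u where "u = sqrt (1 - y\<^sup>2)"
  have nn: "0 \<le> 1 - x\<^sup>2" "0 \<le> 1 - y\<^sup>2"
    using bd by (auto simp: abs_square_le_1)
  have su: "(2 * t * a1 * a2)\<^sup>2 * (s * u) = a1 * a2 * (4 * a1\<^sup>2 * a2\<^sup>2 - (1 - t\<^sup>2)\<^sup>2)"
  proof -
    \<comment> \<open>By Heron's formula, \<open>D\<close> is 16 times the squared area of the triangle.\<close>
    define D where "D = 4 * a1\<^sup>2 * a2\<^sup>2 - (1 - t\<^sup>2)\<^sup>2"
    have b: "a2\<^sup>2 = 1 - a1\<^sup>2" using unit by simp
    have "(2 * t * a2)\<^sup>2 * (1 - x\<^sup>2) = 4 * t\<^sup>2 * a2\<^sup>2 - (t\<^sup>2 + a2\<^sup>2 - a1\<^sup>2)\<^sup>2"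
      unfolding x[symmetric] by (simp add: power2_eq_square algebra_simps)
    also have "\<dots> = D"
      unfolding D_def b by (simp add: power2_eq_square algebra_simps)
    finally have 1: "(2 * t * a2)\<^sup>2 * (1 - x\<^sup>2) = D" .
    have "(2 * t * a1)\<^sup>2 * (1 - y\<^sup>2) = 4 * t\<^sup>2 * a1\<^sup>2 - (t\<^sup>2 + a1\<^sup>2 - a2\<^sup>2)\<^sup>2"
      unfolding y[symmetric] by (simp add: power2_eq_square algebra_simps)
    also have "\<dots> = D"
      unfolding D_def b by (simp add: power2_eq_square algebra_simps)
    finally have 2: "(2 * t * a1)\<^sup>2 * (1 - y\<^sup>2) = D" .
    have s: "2 * t * a2 * s = sqrt D" unfolding 1[symmetric] s_def using pos by (simp add: real_sqrt_mult)
    have u: "2 * t * a1 * u = sqrt D" unfolding 2[symmetric] u_def using pos by (simp add: real_sqrt_mult)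
    have "0 \<le> D" unfolding 1[symmetric] using nn by simp
    have "(2 * t * a1 * a2)\<^sup>2 * (s * u) = a1 * a2 * ((2 * t * a2 * s) * (2 * t * a1 * u))"
      by (simp add: power2_eq_square)
    also have "\<dots> = a1 * a2 * D" unfolding s u using \<open>0 \<le> D\<close> by simp
    finally show ?thesis unfolding D_def .
  qed
  have xy: "(2 * t * a1 * a2)\<^sup>2 * (x * y) = a1 * a2 * ((t\<^sup>2 + a2\<^sup>2 - a1\<^sup>2) * (t\<^sup>2 + a1\<^sup>2 - a2\<^sup>2))"
    unfolding x[symmetric] y[symmetric] by (simp add: power2_eq_square)
  have trig: "sin (arccos x) = s" "sin (arccos y) = u" "cos (arccos x) = x" "cos (arccos y) = y"
    using bd by (auto simp: sin_arccos s_def u_def)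
  have a2sq: "a2\<^sup>2 = 1 - a1\<^sup>2" using unit by simp

  have nz: "(2 * t * a1 * a2)\<^sup>2 \<noteq> 0" using pos by simp
  have "sin (arccos x + arccos y - pi / 2) = s * u - x * y"
    by (simp add: sin_diff cos_add trig)
  also have "\<dots> = (1 - t\<^sup>2) / (2 * a1 * a2)"
  proof -
    have "(2 * t * a1 * a2)\<^sup>2 * (s * u - x * y) = (2 * t * a1 * a2)\<^sup>2 * ((1 - t\<^sup>2) / (2 * a1 * a2))"
    proof -
      have "(2 * t * a1 * a2)\<^sup>2 * ((1 - t\<^sup>2) / (2 * a1 * a2)) = a1 * a2 * (2 * t\<^sup>2 * (1 - t\<^sup>2))"
        using pos by (simp add: power2_eq_square)
      moreover have "4 * a1\<^sup>2 * a2\<^sup>2 - (1 - t\<^sup>2)\<^sup>2 - (t\<^sup>2 + a2\<^sup>2 - a1\<^sup>2) * (t\<^sup>2 + a1\<^sup>2 - a2\<^sup>2) = 2 * t\<^sup>2 * (1 - t\<^sup>2)"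
        unfolding a2sq by (simp add: power2_eq_square algebra_simps)
      ultimately show ?thesis
        by (simp only: right_diff_distrib[of "(2 * t * a1 * a2)\<^sup>2"] su xy flip: right_diff_distrib[of "a1 * a2"])
    qed
    then show ?thesis by (rule mult_left_cancel[OF nz, THEN iffD1])
  qed
  finally show ?thesis1
    using ang by (intro arcsin_unique) auto

  have "sin (arccos y - arccos x + pi / 2) = x * y + s * u"
    by (simp add: sin_add cos_diff trig)
  also have "\<dots> = (4 * a1\<^sup>2 * a2\<^sup>2 - (1 - t\<^sup>2)) / (2 * a1 * a2 * t\<^sup>2)"
  proof -
    have "(2 * t * a1 * a2)\<^sup>2 * (x * y + s * u) = (2 * t * a1 * a2)\<^sup>2 * ((4 * a1\<^sup>2 * a2\<^sup>2 - (1 - t\<^sup>2)) / (2 * a1 * a2 * t\<^sup>2))"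
    proof -
      have "(2 * t * a1 * a2)\<^sup>2 * ((4 * a1\<^sup>2 * a2\<^sup>2 - (1 - t\<^sup>2)) / (2 * a1 * a2 * t\<^sup>2))
          = a1 * a2 * (2 * (4 * a1\<^sup>2 * a2\<^sup>2 - (1 - t\<^sup>2)))"
        using pos by (simp add: power2_eq_square)
      moreover have "(t\<^sup>2 + a2\<^sup>2 - a1\<^sup>2) * (t\<^sup>2 + a1\<^sup>2 - a2\<^sup>2) + (4 * a1\<^sup>2 * a2\<^sup>2 - (1 - t\<^sup>2)\<^sup>2) = 2 * (4 * a1\<^sup>2 * a2\<^sup>2 - (1 - t\<^sup>2))"
        unfolding a2sq by (simp add: power2_eq_square algebra_simps)
      ultimately show ?thesis
        by (simp only: distrib_left[of "(2 * t * a1 * a2)\<^sup>2"] su xy flip: distrib_left[of "a1 * a2"])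
    qed
    then show ?thesis by (rule mult_left_cancel[OF nz, THEN iffD1])
  qed
  finally show ?thesis2
    using ang by (intro arcsin_unique) auto
qed

section \<open>The section of the polydisc as a planar region\<close>

definition vec_of_complex :: "complex \<Rightarrow> real^2"
  where "vec_of_complex z = vector [Re z, Im z]"

lemma norm_vec_of_complex [simp]: "norm (vec_of_complex z) = cmod z"
  by (simp add: vec_of_complex_def norm_vec_def L2_set_def sum_2 cmod_def)

lemma linear_vec_of_complex: "linear vec_of_complex"
  by (simp add: linear_iff vec_of_complex_def vec2_eq_iff)

lemma cscalar_real2:
  fixes a z :: "complex^2"
  assumes "a = vector [complex_of_real a1, complex_of_real a2]"
  shows "cscalar a z = complex_of_real t \<longleftrightarrow> complex_of_real a1 * z$1 + complex_of_real a2 * z$2 = complex_of_real t"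
proof -
  have "cscalar a z = cnj (complex_of_real a1 * z$1 + complex_of_real a2 * z$2)"
    by (simp add: cscalar_def sum_2 assms)
  then show ?thesis by (metis complex_cnj_cnj complex_cnj_complex_of_real)
qed

text \<open>The measure on an affine subspace is defined through an arbitrarily chosen frame, so some
  frame has to exist. The origin is the point \<open>t * a\<close> nearest to \<open>0\<close>; the directions are the unit
  vector \<open>(-a2, a1)\<close>, orthogonal to \<open>a\<close>, and its multiple by \<open>\<i>\<close>.\<close>

lemma flat_frame_section:
  fixes a1 a2 t :: real
  assumes unit: "a1\<^sup>2 + a2\<^sup>2 = 1"
  shows "\<exists>p b. flat_frame 2
    {z::complex^2. complex_of_real a1 * z$1 + complex_of_real a2 * z$2 = complex_of_real t} p b"
proof -
  define p where "p = (vector [complex_of_real (a1 * t), complex_of_real (a2 * t)] :: complex^2)"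
  define b where "b i = (if i = 0 then vector [- complex_of_real a2, complex_of_real a1]
      else vector [- complex_of_real a2 * \<i>, complex_of_real a1 * \<i>] :: complex^2)" for i :: nat
  let ?H = "{z::complex^2. complex_of_real a1 * z$1 + complex_of_real a2 * z$2 = complex_of_real t}"
  have u: "complex_of_real a1 * complex_of_real a1 + complex_of_real a2 * complex_of_real a2 = 1"
    using unit by (simp add: power2_eq_square flip: of_real_mult of_real_add)
  have u': "a1 * a1 + a2 * a2 = 1" using unit by (simp add: power2_eq_square)
  have S: "(\<Sum>i<2. x i *\<^sub>R b i) = x 0 *\<^sub>R b 0 + x 1 *\<^sub>R b 1" for x :: "nat \<Rightarrow> real"
    by (simp add: numeral_2_eq_2)
  have "\<forall>i<2. \<forall>j<2. b i \<bullet> b j = (if i = j then 1 else 0)"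
    using u' by (auto simp: b_def inner_vec_def sum_2 inner_complex_def less_2_cases_iff)
  moreover have "?H = range (\<lambda>x. p + (\<Sum>i<2. x i *\<^sub>R b i))"
  proof (intro equalityI subsetI)
    fix z assume "z \<in> ?H"
    then have z: "complex_of_real a1 * z$1 + complex_of_real a2 * z$2 = complex_of_real t" by simp
    \<comment> \<open>The complex coordinate of \<open>z\<close> along \<open>(-a2, a1)\<close>.\<close>
    define w where "w = complex_of_real a1 * z$2 - complex_of_real a2 * z$1"
    have w: "w = complex_of_real (Re w) + complex_of_real (Im w) * \<i>"
      by (simp add: complex_eq_iff)
    have 1: "z$1 = complex_of_real a1 * complex_of_real t - complex_of_real a2 * w"
      unfolding z[symmetric] w_def using u by algebra
    have 2: "z$2 = complex_of_real a2 * complex_of_real t + complex_of_real a1 * w"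
      unfolding z[symmetric] w_def using u by algebra
    have "z = p + (\<Sum>i<2. (if i = 0 then Re w else Im w) *\<^sub>R b i)"
      unfolding S vec2_eq_iff
      by (simp add: p_def b_def 1 2, subst (1 2) w) (simp add: scaleR_conv_of_real algebra_simps)
    then show "z \<in> range (\<lambda>x. p + (\<Sum>i<2. x i *\<^sub>R b i))"
      by (rule range_eqI[where x = "\<lambda>i. if i = 0 then Re w else Im w"])
  next
    fix z assume "z \<in> range (\<lambda>x. p + (\<Sum>i<2. x i *\<^sub>R b i))"
    then obtain x where x: "z = p + (\<Sum>i<2. x i *\<^sub>R b i)" by blast
    have "complex_of_real a1 * z$1 + complex_of_real a2 * z$2
      = (complex_of_real a1 * complex_of_real a1 + complex_of_real a2 * complex_of_real a2) * complex_of_real t"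
      unfolding x S by (simp add: p_def b_def) (simp add: scaleR_conv_of_real algebra_simps)
    then show "z \<in> ?H" by (simp add: u)
  qed
  ultimately show ?thesis unfolding flat_frame_def by blast
qed

text \<open>Nothing is known about the chosen frame except that it is one, which is all that the
  computation of the area may rely on.\<close>

lemma measure_flat_lborel_2:
  assumes "\<exists>p b. flat_frame 2 H p b" and "A \<in> sets borel"
  obtains p b where "flat_frame 2 H p b"
    and "measure (flat_lborel 2 H) A = measure lborel {v::real^2. p + v$1 *\<^sub>R b 0 + v$2 *\<^sub>R b 1 \<in> A}"
proof -
  obtain p b where pb: "(SOME (p, b). flat_frame 2 H p b) = (p, b)" by (cases "SOME (p, b). flat_frame 2 H p b")
  have "\<exists>q. (case q of (p, b) \<Rightarrow> flat_frame 2 H p b)" using assms by auto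
  from someI_ex[OF this] have frame: "flat_frame 2 H p b" by (simp add: pb)
  define h where "h v = p + v$1 *\<^sub>R b 0 + v$2 *\<^sub>R b 1" for v :: "real^2"
  have h [measurable]: "h \<in> borel_measurable borel"
    unfolding h_def by (intro borel_measurable_continuous_onI continuous_intros)
  let ?g = "\<lambda>x::nat\<Rightarrow>real. vector [x 0, x 1] :: real^2"
  have g: "?g \<in> borel_measurable (Pi\<^sub>M {..<2} (\<lambda>_. lborel))" by measurable
  have "(\<lambda>x. p + (\<Sum>i<2. x i *\<^sub>R b i)) = h \<circ> ?g"
    by (simp add: fun_eq_iff h_def numeral_2_eq_2 add.assoc)
  then have "flat_lborel 2 H = distr (Pi\<^sub>M {..<2} (\<lambda>_. lborel)) borel (h \<circ> ?g)"
    unfolding flat_lborel_def pb by simp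
  also have "\<dots> = distr (distr (Pi\<^sub>M {..<2} (\<lambda>_. lborel)) borel ?g) borel h"
    by (rule distr_distr[symmetric, OF h g])
  also have "\<dots> = distr lborel borel h" by (simp only: flip: lborel_vec2_PiM)
  finally have "measure (flat_lborel 2 H) A = measure (distr lborel borel h) A" by simp
  also have "\<dots> = measure lborel (h -` A)"
    using measure_distr[of h lborel borel A] h assms by simp
  also have "h -` A = {v. p + v$1 *\<^sub>R b 0 + v$2 *\<^sub>R b 1 \<in> A}" by (auto simp: h_def)
  finally show thesis using that frame by blast
qed

text \<open>On the section \<open>z$1 = (t - a2 * z$2) / a1\<close>, so the point is determined by \<open>w = z$2\<close>, and the two
  constraints of the polydisc become the two constraints on \<open>w\<close>. The projection to \<open>w\<close> shrinks areas
  by the factor \<open>a1\<^sup>2\<close>: a direction \<open>u\<close> of the section satisfies \<open>a1 * u$1 = - a2 * u$2\<close>, so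
  the norm of \<open>u$2\<close> is \<open>a1\<close> times that of \<open>u\<close>. Hence in the coordinates of any frame the
  projection is \<open>a1\<close> times an orthogonal map, followed by a translation.\<close>

lemma A_inf_C_eq_measure_discs:
  fixes a1 a2 t :: real and a :: "complex ^ 2"
  assumes pos: "0 < a1" and unit: "a1\<^sup>2 + a2\<^sup>2 = 1"
    and a: "a = vector [complex_of_real a1, complex_of_real a2]"
  shows "A_inf_C a (complex_of_real t)
    = measure lebesgue {w::real^2. norm w \<le> 1 \<and> norm (vector [t, 0] - a2 *\<^sub>R w) \<le> a1} / a1\<^sup>2"
    (is "_ = measure lebesgue ?L / _")
proof -
  define H where "H = {z::complex^2. complex_of_real a1 * z$1 + complex_of_real a2 * z$2 = complex_of_real t}"
  have H: "{z. cscalar a z = complex_of_real t} = H"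
    by (simp add: H_def cscalar_real2[OF a])
  have dom: "{z \<in> polydisc. cscalar a z = complex_of_real t} = polydisc \<inter> H" using H by blast
  have "closed (polydisc \<inter> H)"
    unfolding polydisc_def H_def
    by (intro closed_Int closed_Collect_all closed_Collect_le closed_Collect_eq continuous_intros)
  then have borel: "polydisc \<inter> H \<in> sets borel" by simp
  obtain p b where frame: "flat_frame 2 H p b"
    and area: "measure (flat_lborel 2 H) (polydisc \<inter> H)
      = measure lborel {v::real^2. p + v$1 *\<^sub>R b 0 + v$2 *\<^sub>R b 1 \<in> polydisc \<inter> H}"
    using measure_flat_lborel_2[OF flat_frame_section[OF unit, of t, folded H_def] borel] by blast
  define E where "E = {v::real^2. p + v$1 *\<^sub>R b 0 + v$2 *\<^sub>R b 1 \<in> polydisc \<inter> H}"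
  have A: "A_inf_C a (complex_of_real t) = measure lborel E"
    using area by (simp add: A_inf_C_def H dom E_def)
  have inH: "p + x *\<^sub>R b 0 + y *\<^sub>R b 1 \<in> H" for x y
  proof -
    have "p + (\<Sum>i<2. (if i = 0 then x else y) *\<^sub>R b i) \<in> H"
    proof -
      have "H = range (\<lambda>x. p + (\<Sum>i<2. x i *\<^sub>R b i))"
        using frame unfolding flat_frame_def by blast
      then show ?thesis by (simp only:) (rule range_eqI[OF refl])
    qed
    then show ?thesis by (simp add: numeral_2_eq_2 add.assoc)
  qed
  have dir: "complex_of_real a1 * b i $ 1 = - complex_of_real a2 * b i $ 2" if "i < 2" for i
  proof -
    let ?l = "\<lambda>z::complex^2. complex_of_real a1 * z $ 1 + complex_of_real a2 * z $ 2"
    have "p + b i \<in> H" using inH[of 1 0] inH[of 0 1] that by (auto simp: less_2_cases_iff)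
    moreover have "p \<in> H" using inH[of 0 0] by simp
    moreover have "?l (p + b i) = ?l p + ?l (b i)" by (simp add: algebra_simps)
    ultimately have "?l (b i) = 0" by (simp add: H_def)
    then show ?thesis by (simp add: eq_neg_iff_add_eq_0)
  qed
  have ortho: "b i $ 2 \<bullet> b j $ 2 = (if i = j then a1\<^sup>2 else 0)" if "i < 2" "j < 2" for i j
  proof -
    have "a1\<^sup>2 * (b i $ 1 \<bullet> b j $ 1) = (complex_of_real a1 * b i $ 1) \<bullet> (complex_of_real a1 * b j $ 1)"
      by (simp add: power2_eq_square flip: scaleR_conv_of_real)
    also have "\<dots> = a2\<^sup>2 * (b i $ 2 \<bullet> b j $ 2)"
      unfolding dir[OF that(1)] dir[OF that(2)] by (simp add: power2_eq_square flip: scaleR_conv_of_real)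
    finally have "a1\<^sup>2 * (b i \<bullet> b j) = (a1\<^sup>2 + a2\<^sup>2) * (b i $ 2 \<bullet> b j $ 2)"
      by (simp add: inner_vec_def sum_2 algebra_simps)
    moreover have "b i \<bullet> b j = (if i = j then 1 else 0)"
      using frame that unfolding flat_frame_def by blast
    ultimately show ?thesis using unit by (simp split: if_splits)
  qed
  \<comment> \<open>\<open>T\<close> is the projection to the second component in frame coordinates, \<open>f\<close> its orthogonal part.\<close>
  define f where "f v = vec_of_complex ((v$1 / a1) *\<^sub>R (b 0 $ 2) + (v$2 / a1) *\<^sub>R (b 1 $ 2))" for v :: "real^2"
  define T where "T v = a1 *\<^sub>R f v + vec_of_complex (p $ 2)" for v
  have "linear f"
    unfolding f_def
    by (simp add: linear_iff linear_add[OF linear_vec_of_complex] linear_scale[OF linear_vec_of_complex]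
        add_divide_distrib algebra_simps)
  have norm_f: "norm (f v) = norm v" for v
  proof -
    let ?w = "(v$1 / a1) *\<^sub>R (b 0 $ 2) + (v$2 / a1) *\<^sub>R (b 1 $ 2)"
    have "(norm (f v))\<^sup>2 = ?w \<bullet> ?w"
      by (simp add: f_def power2_norm_eq_inner)
    also have "\<dots> = (v$1)\<^sup>2 + (v$2)\<^sup>2"
      using pos by (simp add: inner_add_left inner_add_right ortho power2_eq_square)
    also have "\<dots> = (norm v)\<^sup>2"
      by (simp add: norm_vec_def L2_set_def sum_2)
    finally show ?thesis by (simp add: power2_eq_iff_nonneg)
  qed
  have orth: "orthogonal_transformation f"
    using \<open>linear f\<close> norm_f by (simp add: orthogonal_transformation)
  have T_eq: "T v = vec_of_complex ((p + v$1 *\<^sub>R b 0 + v$2 *\<^sub>R b 1) $ 2)" for v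
    using pos by (simp add: T_def f_def vec_of_complex_def vec2_eq_iff field_simps)
  have E_iff: "v \<in> E \<longleftrightarrow> T v \<in> ?L" for v
  proof -
    define z where "z = p + v$1 *\<^sub>R b 0 + v$2 *\<^sub>R b 1"
    have z: "z \<in> H" unfolding z_def by (rule inH)
    then have "complex_of_real a1 * z$1 = complex_of_real t - complex_of_real a2 * z$2"
      by (simp add: H_def algebra_simps)
    then have "a1 * cmod (z$1) = cmod (complex_of_real t - complex_of_real a2 * z$2)"
      using pos by (metis abs_of_pos norm_mult norm_of_real)
    also have "\<dots> = norm (vec_of_complex (complex_of_real t - complex_of_real a2 * z$2))" by simp
    also have "vec_of_complex (complex_of_real t - complex_of_real a2 * z$2) = vector [t, 0] - a2 *\<^sub>R T v"
      unfolding T_eq z_def[symmetric] by (simp add: vec_of_complex_def vec2_eq_iff)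
    finally have "cmod (z$1) \<le> 1 \<longleftrightarrow> norm (vector [t, 0] - a2 *\<^sub>R T v) \<le> a1"
      using pos by (metis mult.right_neutral mult_le_cancel_left_pos)
    moreover have "norm (T v) = cmod (z$2)" by (simp add: T_eq z_def)
    moreover have "v \<in> E \<longleftrightarrow> z \<in> polydisc \<inter> H"
      by (simp only: E_def z_def mem_Collect_eq)
    ultimately show ?thesis using z by (auto simp: polydisc_def forall_2)
  qed
  have "surj T"
  proof (rule surjI)
    fix w
    show "T (inv f ((1 / a1) *\<^sub>R (w - vec_of_complex (p $ 2)))) = w"
      using pos by (simp add: T_def surj_f_inv_f[OF orthogonal_transformation_surj[OF orth]])
  qed
  then have "?L = T ` E" using E_iff by (auto simp: image_iff) (metis surjD)
  also have "\<dots> = (\<lambda>w. a1 *\<^sub>R w + vec_of_complex (p $ 2)) ` (f ` E)"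
    by (simp add: T_def image_image)
  finally have "measure lebesgue ?L = a1\<^sup>2 * measure lebesgue (f ` E)"
    using pos measure_lebesgue_affine[of a1 "vec_of_complex (p $ 2)" "f ` E"] by simp
  also have "measure lebesgue (f ` E) = measure lebesgue E"
  proof (rule measure_orthogonal_image[OF orth])
    have "continuous_on UNIV (\<lambda>v::real^2. p + v$1 *\<^sub>R b 0 + v$2 *\<^sub>R b 1)"
      by (intro continuous_intros)
    from closed_vimage[OF \<open>closed (polydisc \<inter> H)\<close> this] have "closed E"
      by (simp add: E_def vimage_def)
    moreover have "bounded E"
    proof (rule boundedI)
      fix v assume "v \<in> E"
      then have "norm (T v) \<le> 1" using E_iff by simp
      then have "norm (a1 *\<^sub>R f v) \<le> 1 + norm (vec_of_complex (p $ 2))"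
        using norm_triangle_ineq4[of "T v" "vec_of_complex (p $ 2)"] by (simp add: T_def)
      then show "norm v \<le> (1 + norm (vec_of_complex (p $ 2))) / a1"
        using pos by (simp add: norm_f field_simps)
    qed
    ultimately show "E \<in> lmeasurable"
      by (simp add: lmeasurable_compact compact_eq_bounded_closed)
  qed
  also have "\<dots> = measure lborel E"
  proof -
    have "E \<in> sets borel"
    proof -
      have "(\<lambda>v::real^2. p + v$1 *\<^sub>R b 0 + v$2 *\<^sub>R b 1) \<in> borel_measurable borel"
        by (intro borel_measurable_continuous_onI continuous_intros)
      from measurable_sets[OF this borel] show ?thesis by (simp add: E_def vimage_def)
    qed
    then show ?thesis by simp
  qed
  finally show ?thesis using A pos by simp
qed

section \<open>The area of the section\<close>

theorem proposition6p1:
  fixes a1 a2 t :: real and a :: "complex ^ 2"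
  assumes "1 \<ge> a1" and "a1 \<ge> a2" and "a2 \<ge> 0"
    and "a1\<^sup>2 + a2\<^sup>2 = 1"
    and "a = vector [complex_of_real a1, complex_of_real a2]"
    and "0 \<le> t" and "t \<le> sqrt 2"
  shows "(0 \<le> t \<and> t \<le> a1 - a2 \<longrightarrow>
           A_inf_C a (complex_of_real t) = pi / a1\<^sup>2) \<and>
         (a1 - a2 \<le> t \<and> t < a1 + a2 \<and> \<not> (t = 0 \<and> a1 - a2 = 0) \<longrightarrow>
           A_inf_C a (complex_of_real t) = phi a1 a2 t)"
proof -
  have a1: "0 < a1"
  proof (rule ccontr)
    assume "\<not> 0 < a1"
    then have "a1 = 0" "a2 = 0" using assms by auto
    then show False using assms(4) by simp
  qed
  let ?L = "{w::real^2. norm w \<le> 1 \<and> norm (vector [t, 0] - a2 *\<^sub>R w) \<le> a1}"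
  have area: "A_inf_C a (complex_of_real t) = measure lebesgue ?L / a1\<^sup>2"
    by (rule A_inf_C_eq_measure_discs[OF a1 assms(4,5)])
  have contained: "A_inf_C a (complex_of_real t) = pi / a1\<^sup>2" if "t \<le> a1 - a2"
  proof -
    \<comment> \<open>The whole unit disc then satisfies the second constraint.\<close>
    have "norm (vector [t, 0] - a2 *\<^sub>R w) \<le> a1" if "norm w \<le> 1" for w :: "real^2"
    proof -
      have "norm (vector [t, 0] :: real^2) = t"
        using assms(6) by (simp add: norm_vec_def L2_set_def sum_2)
      moreover have "norm (a2 *\<^sub>R w) \<le> a2"
        using that assms(3) by (simp add: mult_left_le)
      ultimately show ?thesis
        using norm_triangle_ineq4[of "vector [t, 0]" "a2 *\<^sub>R w"] \<open>t \<le> a1 - a2\<close> by linarith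
    qed
    then have "?L = cball 0 1" by auto
    then have "measure lebesgue ?L = pi"
      by (simp add: content_cball unit_ball_vol_2)
    then show ?thesis using area by simp
  qed
  have lens: "A_inf_C a (complex_of_real t) = phi a1 a2 t"
    if t: "a1 - a2 \<le> t" "t < a1 + a2" and nondeg: "\<not> (t = 0 \<and> a1 - a2 = 0)"
  proof -
    \<comment> \<open>If \<open>a2 = 0\<close>, the bounds on \<open>t\<close> would contradict each other.\<close>
    have a2: "0 < a2"
    proof (rule ccontr)
      assume "\<not> 0 < a2"
      then have "a2 = 0" using assms(3) by simp
      then show False using t by simp
    qed
    have t0: "0 < t" using t nondeg assms(2,6) by linarith
    define x where "x = (t\<^sup>2 + a2\<^sup>2 - a1\<^sup>2) / (2 * t * a2)"
    define y where "y = (t\<^sup>2 + a1\<^sup>2 - a2\<^sup>2) / (2 * t * a1)"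
    define S where "S = sqrt (4 * a1\<^sup>2 * a2\<^sup>2 - (1 - t\<^sup>2)\<^sup>2)"
    have "norm (vector [t, 0] - a2 *\<^sub>R w) = a2 * norm (w - vector [t / a2, 0])" for w :: "real^2"
    proof -
      have "vector [t, 0] - a2 *\<^sub>R w = (- a2) *\<^sub>R (w - vector [t / a2, 0])"
        using a2 by (simp add: vec2_eq_iff algebra_simps)
      then show ?thesis using a2 by simp
    qed
    \<comment> \<open>Dividing by \<open>a2\<close> gives a lens of discs of radii \<open>1\<close> and \<open>a1 / a2\<close> at distance \<open>t / a2\<close>.\<close>
    then have "?L = {w. norm w \<le> 1 \<and> norm (w - vector [t / a2, 0]) \<le> a1 / a2}"
      using a2 by (simp add: pos_le_divide_eq mult.commute)
    then have "measure lebesgue ?L = arccos x + a1\<^sup>2 / a2\<^sup>2 * arccos y - S / a2\<^sup>2 / 2"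
    proof -
      have "\<bar>1 - a1 / a2\<bar> = (a1 - a2) / a2"
        using a2 assms(2) by (simp add: abs_if diff_divide_distrib)
      moreover have "(a1 - a2) / a2 \<le> t / a2"
        using a2 t by (intro divide_right_mono) auto
      ultimately have "\<bar>1 - a1 / a2\<bar> \<le> t / a2" by simp
      moreover have "t / a2 \<le> 1 + a1 / a2" using a2 t by (simp add: field_simps)
      moreover have "((t / a2)\<^sup>2 + 1\<^sup>2 - (a1 / a2)\<^sup>2) / (2 * (t / a2) * 1) = x"
        using a2 t0 by (simp add: x_def field_simps power2_eq_square)
      moreover have "((t / a2)\<^sup>2 + (a1 / a2)\<^sup>2 - 1\<^sup>2) / (2 * (t / a2) * (a1 / a2)) = y"
        using a1 a2 t0 by (simp add: y_def field_simps power2_eq_square)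
      moreover have "sqrt (4 * (t / a2)\<^sup>2 * 1\<^sup>2 - ((t / a2)\<^sup>2 + 1\<^sup>2 - (a1 / a2)\<^sup>2)\<^sup>2) = S / a2\<^sup>2"
      proof -
        have "4 * (t / a2)\<^sup>2 * 1\<^sup>2 - ((t / a2)\<^sup>2 + 1\<^sup>2 - (a1 / a2)\<^sup>2)\<^sup>2
          = (4 * t\<^sup>2 * a2\<^sup>2 - (t\<^sup>2 + a2\<^sup>2 - a1\<^sup>2)\<^sup>2) / (a2\<^sup>2)\<^sup>2"
          using a2 by (simp add: field_simps power2_eq_square)
        also have "4 * t\<^sup>2 * a2\<^sup>2 - (t\<^sup>2 + a2\<^sup>2 - a1\<^sup>2)\<^sup>2 = 4 * a1\<^sup>2 * a2\<^sup>2 - (1 - t\<^sup>2)\<^sup>2"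
        proof -
          have "a2\<^sup>2 = 1 - a1\<^sup>2" using assms(4) by simp
          then show ?thesis by (simp only:) (simp add: power2_eq_square algebra_simps)
        qed
        finally show ?thesis by (simp only: real_sqrt_divide real_sqrt_abs abs_power2 S_def)
      qed
      ultimately show ?thesis
        using measure_lens[of 1 "a1 / a2" "t / a2"] a1 a2 t0 \<open>?L = _\<close>
        by (simp only: power_divide) simp
    qed
    then have "A_inf_C a (complex_of_real t)
        = (arccos x + a1\<^sup>2 / a2\<^sup>2 * arccos y - S / a2\<^sup>2 / 2) / a1\<^sup>2"
      by (simp only: area)
    also have "\<dots> = (2 * a2\<^sup>2 * arccos x + 2 * a1\<^sup>2 * arccos y - S) / (2 * a1\<^sup>2 * a2\<^sup>2)"
      using a1 a2 by (simp add: field_simps)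
    also have "\<dots> = phi a1 a2 t"
    proof -
      have p: "phi a1 a2 t = (a2\<^sup>2 * pi + (arccos x + arccos y - pi / 2)
          + (a1\<^sup>2 - a2\<^sup>2) * (arccos y - arccos x + pi / 2) - S) / (2 * a1\<^sup>2 * a2\<^sup>2)"
        using triangle_angles[OF a1 a2 t0 assms(2,4)] t a1 a2
        by (simp add: phi_def x_def y_def S_def add_divide_distrib diff_divide_distrib)
      \<comment> \<open>The summand \<open>pi / (2 * a1\<^sup>2)\<close> of \<open>phi\<close> cancels the constants \<open>\<plusminus> pi / 2\<close> of the two arcsines,
        weighted by \<open>1\<close> and \<open>a1\<^sup>2 - a2\<^sup>2\<close>.\<close>
      have "a1\<^sup>2 = 1 - a2\<^sup>2" using assms(4) by simp
      then have "a2\<^sup>2 * pi + (arccos x + arccos y - pi / 2)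
          + (a1\<^sup>2 - a2\<^sup>2) * (arccos y - arccos x + pi / 2) - S
        = 2 * a2\<^sup>2 * arccos x + 2 * a1\<^sup>2 * arccos y - S"
        by (simp only:) (simp add: field_simps)
      then show ?thesis by (simp only: p)
    qed
    finally show ?thesis .
  qed
  show ?thesis using contained lens by blast
qed

end
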